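(* There exist absolute constants $A,B,N_0>0$ such that for every real number $N\ge N_0$, every circle $C\subset\mathbf{R}^2$, and every integer distance set $S\subset C$, we have $$\left|S\cap[-N,N]^2\right|\le A\,N^{B/\log\log N}.$$
   Context: A subset $S\subset\mathbf{R}^2$ is an integer distance set if the Euclidean distance between every pair of points of $S$ is an integer. Circles have arbitrary center and arbitrary positive radius. $|\cdot|$ denotes cardinality. *)

theory Defs
  imports "HOL-Analysis.Analysis"
begin

definition integer_distance_set :: "(real ^ 2) set \<Rightarrow> bool" where
  "integer_distance_set S \<longleftrightarrow> (\<forall>x\<in>S. \<forall>y\<in>S. dist x y \<in> \<int>)"

definition circle :: "(real ^ 2) set \<Rightarrow> bool" where
  "circle C \<longleftrightarrow> (\<exists>c r. r > 0 \<and> C = sphere c r)"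

definition centered_square :: "real \<Rightarrow> (real ^ 2) set" where
  "centered_square N = {x. \<forall>i. x $ i \<in> {-N..N}}"

end

theory Submission
  imports Defs "HOL-Computational_Algebra.Squarefree" "HOL-Number_Theory.Cong"
    "HOL-Real_Asymp.Real_Asymp"
begin

text \<open>
  Write \<open>T\<close> for the part of the integer distance set inside the square and suppose that it
  contains three distinct points \<open>P, Q, Z\<close>. Put \<open>d = |PQ|\<close>, and let \<open>a = |PX|\<close>, \<open>b = |QX|\<close> be the
  distances from \<open>P\<close> and \<open>Q\<close> to another point \<open>X\<close> of \<open>T\<close>. By the inscribed angle theorem the angle
  of the triangle \<open>PQX\<close> at \<open>X\<close> takes only two values, with opposite cosines, so
  \<open>(a\<^sup>2 + b\<^sup>2 - d\<^sup>2) / (a b)\<close> is the same rational number \<open>e / f\<close> for all \<open>X\<close>, up to sign;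
  the point \<open>Z\<close> shows that \<open>f = |PZ| |QZ|\<close> and \<open>e = |PZ|\<^sup>2 + |QZ|\<^sup>2 - d\<^sup>2\<close> will do. Completing the
  square turns this into
    \<open>(2 f a \<mp> e b)\<^sup>2 + (4 f\<^sup>2 - e\<^sup>2) b\<^sup>2 = 4 f\<^sup>2 d\<^sup>2\<close>,
  a representation of one fixed integer \<open>n = 4 f\<^sup>2 d\<^sup>2\<close> by one fixed form \<open>u\<^sup>2 + D v\<^sup>2\<close> with
  \<open>D > 0\<close>. Each pair \<open>(a, b)\<close> belongs to at most two points of the plane
  (\<open>card_points_with_given_distances\<close>), so \<open>T\<close> is controlled by the number of representations
  (\<open>card_integer_distance_set_on_circle\<close>).

  That number is at most \<open>18 \<tau>(n)\<^sup>2\<close> for every \<open>D > 0\<close>, where \<open>\<tau>\<close> counts divisors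
  (\<open>card_representations\<close>). The uniformity in \<open>D\<close> is essential, since \<open>D\<close> depends on the set.
  Absorbing squares into \<open>v\<close> makes \<open>D\<close> squarefree, and pulling out \<open>gcd u v\<close> makes the
  representation primitive. A primitive representation determines a square root \<open>u / v\<close> of \<open>-D\<close>
  modulo \<open>n\<close>; there are few such roots, and few representations with a given root.

  All distances in the square are \<open>O(N)\<close>, so \<open>n = O(N\<^sup>6)\<close>, and the classical maximal order
  \<open>\<tau>(n) \<le> N powr O(1 / ln ln N)\<close> of the divisor function finishes the proof.
\<close>

section \<open>The maximal order of the divisor function\<close>

lemma card_le_by_cover:
  assumes "finite B" "A \<subseteq> (\<Union>b\<in>B. F b)" "\<And>b. b \<in> B \<Longrightarrow> finite (F b) \<and> card (F b) \<le> k"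
  shows "finite A \<and> card A \<le> card B * k"
proof -
  have fin: "finite (\<Union>b\<in>B. F b)" using assms by auto
  have "card A \<le> card (\<Union>b\<in>B. F b)" using fin assms(2) by (rule card_mono)
  also have "\<dots> \<le> (\<Sum>b\<in>B. card (F b))" by (rule card_UN_le[OF assms(1)])
  also have "\<dots> \<le> card B * k" using sum_bounded_above[of B "\<lambda>b. card (F b)" k] assms(3) by simp
  finally show ?thesis using finite_subset[OF assms(2) fin] by blast
qed

definition divisor_count :: "nat \<Rightarrow> nat" where
  "divisor_count n = card {d. d dvd n}"

lemma divisor_count_mono:
  assumes "m dvd n" "n > 0"
  shows "divisor_count m \<le> divisor_count n"
  unfolding divisor_count_def
  using assms by (intro card_mono) (auto intro: dvd_trans)

text \<open>
  A divisor is determined by its exponents at the primes dividing \<open>n\<close>.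
\<close>

lemma divisor_count_le_prod:
  assumes "n > 0"
  shows "divisor_count n \<le> (\<Prod>p\<in>prime_factors n. multiplicity p n + 1)"
proof -
  let ?f = "\<lambda>d. restrict (\<lambda>p. multiplicity p d) (prime_factors n)"
  let ?B = "\<Pi>\<^sub>E p\<in>prime_factors n. {0..multiplicity p n}"
  have "inj_on ?f {d. d dvd n}"
  proof (rule inj_onI)
    fix d e assume de: "d \<in> {d. d dvd n}" "e \<in> {d. d dvd n}" and eq: "?f d = ?f e"
    show "d = e"
    proof (rule multiplicity_eq_nat)
      show "d > 0" "e > 0" using de assms by (auto intro!: Nat.gr0I)
      fix p :: nat assume p: "prime p"
      show "multiplicity p d = multiplicity p e"
      proof (cases "p dvd n")
        case True
        then have "p \<in> prime_factors n" using p assms by (simp add: prime_factors_dvd)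
        then show ?thesis using fun_cong[OF eq, of p] by simp
      next
        case False
        then have "\<not> p dvd d" "\<not> p dvd e" using de by (auto dest: dvd_trans)
        then show ?thesis by (simp add: not_dvd_imp_multiplicity_0)
      qed
    qed
  qed
  moreover have "?f ` {d. d dvd n} \<subseteq> ?B"
    using assms by (auto intro!: dvd_imp_multiplicity_le)
  moreover have "finite ?B" by (intro finite_PiE) auto
  ultimately have "card {d. d dvd n} \<le> card ?B" by (rule card_inj_on_le)
  then show ?thesis by (simp add: card_PiE divisor_count_def)
qed

text \<open>
  Let \<open>\<delta> = ln 2 / ln y\<close>, so that \<open>y powr \<delta> = 2\<close>. A prime power \<open>p ^ a\<close> in \<open>n\<close> with \<open>p \<ge> y\<close>
  contributes \<open>a + 1 \<le> 2 ^ a \<le> (p ^ a) powr \<delta>\<close>, and these contributions multiply to at most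
  \<open>n powr \<delta>\<close>. There are at most \<open>y\<close> primes below \<open>y\<close>, each contributing
  \<open>a + 1 \<le> 1 + log 2 x\<close>.
\<close>

lemma divisor_count_bound:
  fixes x y :: real
  assumes n: "n > 0" "real n \<le> x" and y: "y > 1"
  shows "real (divisor_count n) \<le> (1 + log 2 x) powr y * x powr (ln 2 / ln y)"
proof -
  define \<delta> where "\<delta> = ln 2 / ln y"
  define L where "L = 1 + log 2 x"
  have \<delta>: "\<delta> > 0" using y by (simp add: \<delta>_def)
  have x1: "x \<ge> 1" using n by linarith
  have L: "L \<ge> 1" using x1 by (simp add: L_def)
  have ydelta: "y powr \<delta> = 2" using y by (simp add: \<delta>_def powr_def)
  let ?P = "prime_factors n"
  have factor: "real (multiplicity p n + 1) \<le> (if real p < y then L else 1) * (real p ^ multiplicity p n) powr \<delta>"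
    if p: "p \<in> ?P" for p
  proof -
    define a where "a = multiplicity p n"
    have pr: "prime p" and p2: "p \<ge> 2" using p by (auto simp: in_prime_factors_iff prime_ge_2_nat)
    have ge1: "(real p ^ a) powr \<delta> \<ge> 1"
      using p2 \<delta> by (intro ge_one_powr_ge_zero) auto
    show ?thesis
    proof (cases "real p < y")
      case True
      have "2 ^ a \<le> p ^ a" using p2 by (intro power_mono) auto
      also have "p ^ a \<le> n" using n by (intro dvd_imp_le) (auto simp: a_def multiplicity_dvd)
      finally have "real (2 ^ a) \<le> x" using n by linarith
      then have "real a \<le> log 2 x" using x1 by (subst le_log_iff) (auto simp: powr_realpow)
      then have "real (a + 1) \<le> L" by (simp add: L_def)
      also have "L \<le> L * (real p ^ a) powr \<delta>" using ge1 L by (simp add: mult_le_cancel_left1)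
      finally show ?thesis using True by (simp add: a_def)
    next
      case False
      have "real (a + 1) \<le> 2 ^ a"
        using less_exp[of a] by (metis Suc_eq_plus1 Suc_leI of_nat_le_iff of_nat_numeral of_nat_power)
      also have "(2::real) ^ a = (y powr \<delta>) ^ a" by (simp add: ydelta)
      also have "\<dots> \<le> (real p powr \<delta>) ^ a"
        using False y \<delta> by (intro power_mono powr_mono2) auto
      also have "\<dots> = (real p ^ a) powr \<delta>"
        using p2 by (simp add: powr_powr powr_realpow[symmetric] mult.commute)
      finally show ?thesis using False by (simp add: a_def)
    qed
  qed
  have "real (divisor_count n) \<le> real (\<Prod>p\<in>?P. multiplicity p n + 1)"
    using divisor_count_le_prod[OF n(1)] by (simp only: of_nat_le_iff)
  also have "\<dots> = (\<Prod>p\<in>?P. real (multiplicity p n + 1))" by (simp only: of_nat_prod)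
  also have "\<dots> \<le> (\<Prod>p\<in>?P. (if real p < y then L else 1) * (real p ^ multiplicity p n) powr \<delta>)"
    by (rule prod_mono) (use factor in auto)
  also have "\<dots> = (\<Prod>p\<in>?P. if real p < y then L else 1) * (\<Prod>p\<in>?P. (real p ^ multiplicity p n) powr \<delta>)"
    by (rule prod.distrib)
  also have "(\<Prod>p\<in>?P. if real p < y then L else 1) = L ^ card {p\<in>?P. real p < y}"
    by (simp add: prod.If_cases Int_def)
  also have "\<dots> = L powr real (card {p\<in>?P. real p < y})" using L by (simp add: powr_realpow)
  also have "(\<Prod>p\<in>?P. (real p ^ multiplicity p n) powr \<delta>) = (\<Prod>p\<in>?P. real p ^ multiplicity p n) powr \<delta>"
    by (simp add: prod_powr_distrib)
  also have "(\<Prod>p\<in>?P. real p ^ multiplicity p n) = real n"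
    using prime_factorization_nat[OF n(1)] by (metis (mono_tags, lifting) of_nat_power of_nat_prod prod.cong)
  also have "L powr real (card {p\<in>?P. real p < y}) * real n powr \<delta> \<le> L powr y * x powr \<delta>"
  proof (intro mult_mono powr_mono powr_mono2)
    have "{p\<in>?P. real p < y} \<subseteq> {1..nat \<lfloor>y\<rfloor>}"
      by (auto simp: in_prime_factors_iff prime_gt_0_nat Suc_le_eq le_nat_iff le_floor_iff)
    then have "card {p\<in>?P. real p < y} \<le> nat \<lfloor>y\<rfloor>"
      using card_mono[of "{1..nat \<lfloor>y\<rfloor>}"] by fastforce
    then show "real (card {p\<in>?P. real p < y}) \<le> y" using y by linarith
  qed (use n L \<delta> in auto)
  finally show ?thesis by (simp add: L_def \<delta>_def)
qed

text \<open>
  The choice \<open>y = sqrt (ln N)\<close> balances the two factors: primes below \<open>y\<close> cost only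
  \<open>exp (o (ln N / ln (ln N)))\<close>, while \<open>ln y\<close> is still half of \<open>ln (ln N)\<close>. The exponent \<open>15\<close>
  leaves \<open>14 = 2 * 7\<close> (using \<open>ln 2 < 1\<close>) for the large primes and \<open>1\<close> for the small ones.
\<close>

lemma eventually_divisor_count_bound:
  "eventually (\<lambda>N::real. \<forall>n>0. real n \<le> N ^ 7 \<longrightarrow>
     real (divisor_count n) \<le> N powr (15 / ln (ln N))) at_top"
proof -
  have 1: "eventually (\<lambda>N::real. (1 + 7 * log 2 N) powr sqrt (ln N) \<le> exp (ln N / ln (ln N))) at_top"
    by real_asymp
  have 2: "eventually (\<lambda>N::real. ln (ln N) > 0) at_top" by real_asymp
  have 3: "eventually (\<lambda>N::real. ln N > 1) at_top" by real_asymp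
  have 4: "eventually (\<lambda>N::real. N > 1) at_top" by real_asymp
  show ?thesis using 1 2 3 4
  proof eventually_elim
    case (elim N)
    show ?case
    proof (intro allI impI)
      fix n :: nat assume n: "n > 0" "real n \<le> N ^ 7"
      let ?y = "sqrt (ln N)"
      have "real (divisor_count n) \<le> (1 + log 2 (N ^ 7)) powr ?y * (N ^ 7) powr (ln 2 / ln ?y)"
        using n elim by (intro divisor_count_bound) auto
      also have "log 2 (N ^ 7) = 7 * log 2 N" using elim by (simp add: log_nat_power)
      also have "(N ^ 7) powr (ln 2 / ln ?y) = exp (14 * ln 2 * ln N / ln (ln N))"
        using elim by (simp add: powr_def ln_sqrt ln_realpow field_simps)
      also have "(1 + 7 * log 2 N) powr ?y * exp (14 * ln 2 * ln N / ln (ln N))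
          \<le> exp (ln N / ln (ln N)) * exp (14 * ln N / ln (ln N))"
        using elim ln_2_less_1 by (intro mult_mono) (auto intro!: divide_right_mono mult_right_mono)
      also have "\<dots> = N powr (15 / ln (ln N))"
        using elim by (simp add: powr_def exp_add[symmetric] field_simps)
      finally show "real (divisor_count n) \<le> N powr (15 / ln (ln N))" .
    qed
  qed
qed

section \<open>Representations by binary quadratic forms\<close>

lemma square_dvd_4_squarefree:
  fixes D h :: int
  assumes D: "squarefree D" and h: "h\<^sup>2 dvd 4 * D"
  shows "h dvd 2"
proof (cases "even h")
  case True
  then obtain k where k: "h = 2 * k" by auto
  then have "k\<^sup>2 dvd D" using h by (simp add: power_mult_distrib)
  then have "k dvd 1" by (rule squarefreeD[OF D])
  then show ?thesis using k by auto
next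
  case False
  then have "coprime (h\<^sup>2) (2 ^ 2)" by (simp only: coprime_power_left_iff coprime_power_right_iff coprime_right_2_iff_odd) simp
  then have "h\<^sup>2 dvd D" using h by (simp add: coprime_dvd_mult_right_iff)
  then have "h dvd 1" by (rule squarefreeD[OF D])
  then show ?thesis by (rule dvd_trans) simp
qed

text \<open>
  Fix one root \<open>t0\<close> and sort the roots \<open>t\<close> by \<open>g = gcd n (t - t0)\<close>. Since \<open>n\<close> divides
  \<open>(t - t0) (t + t0)\<close>, a root in the class of \<open>g\<close> is \<open>t0\<close> modulo \<open>g\<close> and \<open>-t0\<close> modulo \<open>m = n / g\<close>,
  hence is determined modulo \<open>lcm g m = n / h\<close> with \<open>h = gcd g m\<close>. Now \<open>h\<close> divides
  \<open>2 t0\<close> and \<open>h\<^sup>2\<close> divides \<open>n\<close>, so \<open>h\<^sup>2\<close> divides \<open>4 D\<close>, which forces \<open>h\<close> to divide \<open>2\<close> because \<open>D\<close> is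
  squarefree. Without that hypothesis the count fails: \<open>t\<^sup>2 \<equiv> 0\<close> modulo \<open>p\<^sup>2\<close> has \<open>p\<close> roots.
\<close>

lemma card_square_roots_mod:
  fixes D :: int and n :: nat
  assumes D: "squarefree D" and n: "n > 0"
  defines "R \<equiv> {t \<in> {0..<int n}. int n dvd t\<^sup>2 + D}"
  shows "finite R \<and> card R \<le> divisor_count n * 2"
proof (cases "R = {}")
  case False
  then obtain t0 where t0: "int n dvd t0\<^sup>2 + D" by (auto simp: R_def)
  define F where "F g = {t\<in>R. gcd (int n) (t - t0) = int g}" for g :: nat
  have "finite R" unfolding R_def by (rule finite_subset[of _ "{0..<int n}"]) auto
  have fibre: "card (F g) \<le> 2" if g: "g dvd n" for g
  proof -
    obtain m where m: "n = g * m" using g by auto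
    have g0: "g > 0" using m n by auto
    have cong_g: "int g dvd t - t0" if "t \<in> F g" for t
      using that unfolding F_def by (metis (mono_tags, lifting) gcd_dvd2 mem_Collect_eq)
    have cong_m: "int m dvd t + t0" if t: "t \<in> F g" for t
    proof -
      have "int n dvd (t\<^sup>2 + D) - (t0\<^sup>2 + D)" using t t0 by (intro dvd_diff) (auto simp: F_def R_def)
      also have "(t\<^sup>2 + D) - (t0\<^sup>2 + D) = (t - t0) * (t + t0)" by (simp add: power2_eq_square algebra_simps)
      finally have nd: "int n dvd (t - t0) * (t + t0)" .
      obtain s where s: "t - t0 = int g * s" using cong_g[OF t] by auto
      have "gcd (int g * int m) (int g * s) = int g" using t m s by (simp add: F_def)
      then have "coprime (int m) s" using g0 by (simp add: gcd_mult_distrib_int[symmetric] coprime_iff_gcd_eq_1)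
      moreover have "int m dvd s * (t + t0)"
        using nd g0 by (simp add: m s mult.assoc)
      ultimately show ?thesis by (simp add: coprime_dvd_mult_right_iff)
    qed
    \<comment> \<open>The roots in \<open>F g\<close> agree modulo \<open>n / 2\<close>, so each half of \<open>{0..<n}\<close> contains at most one.\<close>
    have "inj_on (\<lambda>t. 2 * t < int n) (F g)"
    proof (rule inj_onI)
      fix t t' assume t: "t \<in> F g" "t' \<in> F g" and eq: "(2 * t < int n) = (2 * t' < int n)"
      let ?h = "gcd (int g) (int m)"
      have "?h dvd (t + t0) - (t - t0)"
        by (intro dvd_diff dvd_trans[OF gcd_dvd1 cong_g[OF t(1)]] dvd_trans[OF gcd_dvd2 cong_m[OF t(1)]])
      then have "?h dvd 2 * t0" by simp
      then have "?h\<^sup>2 dvd (2 * t0)\<^sup>2" by (rule dvd_power_same)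
      moreover have "?h\<^sup>2 dvd 4 * (t0\<^sup>2 + D)"
      proof -
        have "?h * ?h dvd int g * int m" by (intro mult_dvd_mono) auto
        also have "int g * int m dvd t0\<^sup>2 + D" using t0 by (simp add: m)
        finally show ?thesis unfolding power2_eq_square[of ?h] by (rule dvd_mult)
      qed
      ultimately have "?h\<^sup>2 dvd 4 * (t0\<^sup>2 + D) - (2 * t0)\<^sup>2" by (rule dvd_diff[rotated])
      then have h2: "?h dvd 2" by (intro square_dvd_4_squarefree[OF D]) (simp add: power_mult_distrib algebra_simps)
      have "int g dvd (t - t0) - (t' - t0)" by (intro dvd_diff cong_g t)
      moreover have "int m dvd (t + t0) - (t' + t0)" by (intro dvd_diff cong_m t)
      ultimately have "lcm (int g) (int m) dvd t - t'" by (intro lcm_least) auto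
      then have "?h * lcm (int g) (int m) dvd 2 * (t - t')" by (intro mult_dvd_mono h2)
      then have dv: "int n dvd 2 * (t - t')" unfolding gcd_mult_lcm by (simp add: m abs_mult)
      have "\<bar>2 * (t - t')\<bar> < int n" using t eq by (auto simp: F_def R_def)
      then have "2 * (t - t') = 0" using dv zdvd_imp_le[of "int n" "\<bar>2 * (t - t')\<bar>"] by auto
      then show "t = t'" by simp
    qed
    then have "card (F g) \<le> card (UNIV :: bool set)" by (rule card_inj_on_le) auto
    then show ?thesis by simp
  qed
  have "R \<subseteq> (\<Union>g\<in>{g. g dvd n}. F g)"
  proof
    fix t assume t: "t \<in> R"
    have "nat (gcd (int n) (t - t0)) dvd n" by (simp add: nat_dvd_iff)
    then show "t \<in> (\<Union>g\<in>{g. g dvd n}. F g)" using t by (force simp: F_def)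
  qed
  then show ?thesis unfolding divisor_count_def
    using fibre \<open>finite R\<close> n by (intro card_le_by_cover) (auto simp: F_def)
qed auto

text \<open>
  If \<open>gcd u v = 1\<close> then \<open>v\<close> is invertible modulo \<open>n\<close>, and \<open>t = u / v\<close> is a square root of \<open>-D\<close>.
  If \<open>(a, b)\<close> and \<open>(u, v)\<close> have the same root \<open>t\<close>, then \<open>n\<close> divides both \<open>a u + D b v\<close> and
  \<open>a v - b u\<close>, and Brahmagupta's identity
    \<open>(a u + D b v)\<^sup>2 + D (a v - b u)\<^sup>2 = (a\<^sup>2 + D b\<^sup>2) (u\<^sup>2 + D v\<^sup>2) = n\<^sup>2\<close>
  says that the quotients \<open>(k, m)\<close> solve \<open>k\<^sup>2 + D m\<^sup>2 = 1\<close>. So the representations with a given root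
  differ by a unit of \<open>\<int>[\<surd>-D]\<close>; the nine pairs in \<open>{-1..1} \<times> {-1..1}\<close> are a crude bound for the
  number of units.
\<close>

lemma card_primitive_representations:
  fixes D :: int and n :: nat
  assumes D: "squarefree D" "D > 0" and n: "n > 0"
  defines "A \<equiv> {(u, v). u\<^sup>2 + D * v\<^sup>2 = int n \<and> coprime u v}"
  shows "finite A \<and> card A \<le> divisor_count n * 18"
proof -
  define R where "R = {t \<in> {0..<int n}. int n dvd t\<^sup>2 + D}"
  define F where "F t = {(u, v). (u, v) \<in> A \<and> int n dvd u - t * v}" for t
  have R: "finite R" "card R \<le> divisor_count n * 2"
    using card_square_roots_mod[OF D(1) n] by (auto simp: R_def)
  have cover: "A \<subseteq> (\<Union>t\<in>R. F t)"
  proof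
    fix w assume w: "w \<in> A"
    obtain u v where uv: "w = (u, v)" by force
    have rep: "u\<^sup>2 + D * v\<^sup>2 = int n" and cop: "coprime u v" using w by (auto simp: A_def uv)
    have "gcd v (D * v * v + u\<^sup>2) = gcd v (u\<^sup>2)" using gcd_add_mult[of v "D * v" "u\<^sup>2"] by simp
    then have "coprime v (u\<^sup>2 + D * v * v)"
      using cop by (simp add: coprime_iff_gcd_eq_1[symmetric] coprime_commute add.commute)
    then have cv: "coprime v (int n)" using rep by (simp add: power2_eq_square mult.assoc)
    then obtain x where x: "[v * x = 1] (mod int n)" using cong_solve_coprime_int by blast
    define t where "t = (u * x) mod int n"
    have "[t * v = (u * x) * v] (mod int n)" unfolding t_def by (intro cong_mult) auto
    also have "(u * x) * v = u * (v * x)" by simp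
    also have "[u * (v * x) = u * 1] (mod int n)" by (intro cong_mult x) auto
    finally have tv: "[t * v = u] (mod int n)" by simp
    then have dv: "int n dvd u - t * v" by (simp add: cong_iff_dvd_diff dvd_diff_commute)
    have "[(t\<^sup>2 + D) * v\<^sup>2 = u\<^sup>2 + D * v\<^sup>2] (mod int n)"
      using cong_add[OF cong_pow[OF tv, of 2] cong_refl[of "D * v\<^sup>2"]]
      by (simp add: algebra_simps power_mult_distrib)
    then have "int n dvd (t\<^sup>2 + D) * v\<^sup>2" using rep by (auto simp: cong_def)
    moreover have "coprime (int n) (v\<^sup>2)" using cv by (simp add: coprime_commute)
    ultimately have "int n dvd t\<^sup>2 + D" by (simp add: coprime_dvd_mult_left_iff)
    moreover have "t \<in> {0..<int n}" using n by (simp add: t_def)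
    ultimately show "w \<in> (\<Union>t\<in>R. F t)" using w dv by (auto simp: R_def F_def uv)
  qed
  have fibre: "finite (F t) \<and> card (F t) \<le> 9" if t: "t \<in> R" for t
  proof (cases "F t = {}")
    case False
    then obtain a b where ab: "(a, b) \<in> F t" by auto
    \<comment> \<open>This is \<open>(u, v)\<close> divided by \<open>(a, b)\<close> in \<open>\<rat>(\<surd>-D)\<close>.\<close>
    define f where "f = (\<lambda>(u, v). ((a * u + D * b * v) div int n, (a * v - b * u) div int n))"
    have ndt: "int n dvd t\<^sup>2 + D" using t by (simp add: R_def)
    have n_ab: "a\<^sup>2 + D * b\<^sup>2 = int n" using ab by (auto simp: F_def A_def)
    obtain i where i: "a = t * b + int n * i" using ab by (auto simp: F_def dvd_def algebra_simps)
    have props: "int n dvd a * u + D * b * v \<and> int n dvd a * v - b * u \<and> u\<^sup>2 + D * v\<^sup>2 = int n"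
      if uv: "(u, v) \<in> F t" for u v
    proof -
      obtain j where j: "u = t * v + int n * j" using uv by (auto simp: F_def dvd_def algebra_simps)
      have "a * u + D * b * v = (t\<^sup>2 + D) * (b * v) + int n * (t * b * j + i * t * v + int n * i * j)"
        unfolding i j by (simp add: power2_eq_square algebra_simps)
      moreover have "a * v - b * u = int n * (i * v - j * b)"
        unfolding i j by (simp add: power2_eq_square algebra_simps)
      ultimately show ?thesis using uv ndt by (auto simp: F_def A_def)
    qed
    have "inj_on f (F t)"
    proof (rule inj_onI, clarify)
      fix u v u' v' assume uv: "(u, v) \<in> F t" "(u', v') \<in> F t" and eq: "f (u, v) = f (u', v')"
      have 1: "a * u + D * b * v = a * u' + D * b * v'" and 2: "a * v - b * u = a * v' - b * u'"
        using n eq props[OF uv(1)] props[OF uv(2)] by (auto simp: f_def elim!: dvdE)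
      have "int n * u = a * (a * u + D * b * v) - D * b * (a * v - b * u)"
        by (simp add: n_ab[symmetric] power2_eq_square algebra_simps)
      also have "\<dots> = int n * u'" unfolding 1 2
        by (simp add: n_ab[symmetric] power2_eq_square algebra_simps)
      finally have "u = u'" using n by simp
      have "int n * v = a * (a * v - b * u) + b * (a * u + D * b * v)"
        by (simp add: n_ab[symmetric] power2_eq_square algebra_simps)
      also have "\<dots> = int n * v'" unfolding 1 2
        by (simp add: n_ab[symmetric] power2_eq_square algebra_simps)
      finally show "u = u' \<and> v = v'" using n \<open>u = u'\<close> by simp
    qed
    moreover have "f ` F t \<subseteq> {-1..1} \<times> {-1..1}"
    proof (rule image_subsetI)
      fix w assume w: "w \<in> F t"
      obtain u v where w_eq: "w = (u, v)" by force
      have uv: "(u, v) \<in> F t" using w by (simp add: w_eq)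
      obtain k where k: "a * u + D * b * v = int n * k" using props[OF uv] by auto
      obtain m where m: "a * v - b * u = int n * m" using props[OF uv] by auto
      have "(int n)\<^sup>2 * (k\<^sup>2 + D * m\<^sup>2) = (int n * k)\<^sup>2 + D * (int n * m)\<^sup>2"
        by (simp add: power_mult_distrib algebra_simps)
      also have "\<dots> = (a\<^sup>2 + D * b\<^sup>2) * (u\<^sup>2 + D * v\<^sup>2)"
        unfolding k[symmetric] m[symmetric] by (simp add: power2_eq_square algebra_simps)
      also have "\<dots> = (int n)\<^sup>2 * 1" using n_ab props[OF uv] by (simp add: power2_eq_square)
      finally have km: "k\<^sup>2 + D * m\<^sup>2 = 1" using n by simp
      have "m\<^sup>2 \<le> D * m\<^sup>2" using D(2) mult_right_mono[of 1 D "m\<^sup>2"] by simp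
      then have "k\<^sup>2 \<le> 1" "m\<^sup>2 \<le> 1" using km zero_le_power2[of k] zero_le_power2[of m] by linarith+
      then have "\<bar>k\<bar> \<le> 1" "\<bar>m\<bar> \<le> 1" by (simp_all add: abs_square_le_1)
      then show "f w \<in> {-1..1} \<times> {-1..1}" using n by (auto simp: w_eq f_def k m)
    qed
    moreover have "finite ({-1..1::int} \<times> {-1..1::int})" by simp
    ultimately have "finite (F t)" "card (F t) \<le> card ({-1..1::int} \<times> {-1..1::int})"
      using inj_on_finite card_inj_on_le by blast+
    then show ?thesis by (simp add: card_cartesian_product)
  qed auto
  have "finite A \<and> card A \<le> card R * 9"
    by (rule card_le_by_cover[OF R(1) cover fibre])
  then show ?thesis using R(2) by linarith
qed

text \<open>
  Dividing a representation by \<open>g = gcd u v\<close> gives a primitive representation of \<open>n / g\<^sup>2\<close>, and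
  both the number of possible \<open>g\<close> and \<open>\<tau>(n / g\<^sup>2)\<close> are at most \<open>\<tau>(n)\<close>.
\<close>

lemma card_representations_squarefree:
  fixes D :: int and n :: nat
  assumes D: "squarefree D" "D > 0" and n: "n > 0"
  defines "A \<equiv> {(u, v). u\<^sup>2 + D * v\<^sup>2 = int n}"
  shows "finite A \<and> card A \<le> divisor_count n * (divisor_count n * 18)"
proof -
  define P where "P m = {(u, v). u\<^sup>2 + D * v\<^sup>2 = int m \<and> coprime u v}" for m :: nat
  define G where "G = {g. g\<^sup>2 dvd n}"
  define F where "F g = (\<lambda>(u, v). (int g * u, int g * v)) ` P (n div g\<^sup>2)" for g
  have Gsub: "G \<subseteq> {g. g dvd n}"
    by (auto simp: G_def power2_eq_square intro: dvd_trans[OF dvd_triv_left])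
  then have G: "finite G" "card G \<le> divisor_count n"
    unfolding divisor_count_def using n by (auto intro: finite_subset card_mono)
  have "A \<subseteq> (\<Union>g\<in>G. F g)"
  proof
    fix w assume w: "w \<in> A"
    obtain u v where uv: "w = (u, v)" by force
    have rep: "u\<^sup>2 + D * v\<^sup>2 = int n" using w by (simp add: A_def uv)
    then have "u \<noteq> 0 \<or> v \<noteq> 0" using n by auto
    then obtain u' v' where uv': "u = u' * gcd u v" "v = v' * gcd u v" "coprime u' v'"
      using gcd_coprime_exists[of u v] by auto
    define g where "g = nat (gcd u v)"
    have u: "u = int g * u'" and v: "v = int g * v'" using uv' by (simp_all add: g_def mult.commute)
    have eq: "int n = int (g\<^sup>2) * (u'\<^sup>2 + D * v'\<^sup>2)"
      by (simp add: rep[symmetric] u v power_mult_distrib algebra_simps)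
    then have dv: "g\<^sup>2 dvd n" by (metis dvd_triv_left int_dvd_int_iff)
    then obtain m where m: "n = g\<^sup>2 * m" by auto
    have g0: "g > 0" using m n by (auto intro!: Nat.gr0I)
    have "u'\<^sup>2 + D * v'\<^sup>2 = int m" using eq g0 by (simp add: m)
    moreover have "n div g\<^sup>2 = m" using g0 by (simp add: m)
    ultimately have "(u', v') \<in> P (n div g\<^sup>2)" using uv' by (simp add: P_def)
    then have "w \<in> F g" unfolding F_def uv u v by (rule rev_image_eqI) simp
    then show "w \<in> (\<Union>g\<in>G. F g)" using dv by (auto simp: G_def)
  qed
  moreover have "finite (F g) \<and> card (F g) \<le> divisor_count n * 18" if g: "g \<in> G" for g
  proof -
    let ?m = "n div g\<^sup>2"
    have gm: "n = g\<^sup>2 * ?m" using g by (simp add: G_def)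
    then have m0: "?m > 0" using n by (metis mult_0_right neq0_conv)
    have md: "?m dvd n" using gm by (metis dvd_triv_right)
    have P: "finite (P ?m) \<and> card (P ?m) \<le> divisor_count ?m * 18"
      unfolding P_def by (rule card_primitive_representations[OF D m0])
    then have "card (F g) \<le> card (P ?m)" unfolding F_def by (intro card_image_le) auto
    also have "\<dots> \<le> divisor_count n * 18" using P divisor_count_mono[OF md n] by linarith
    finally show ?thesis using P by (simp add: F_def)
  qed
  ultimately have "finite A \<and> card A \<le> card G * (divisor_count n * 18)"
    by (rule card_le_by_cover[OF G(1)])
  then show ?thesis using mult_right_mono[OF G(2), of "divisor_count n * 18"] by linarith
qed

text \<open>
  If \<open>D = E s\<^sup>2\<close> with \<open>E\<close> squarefree, then \<open>(u, v) \<mapsto> (u, s v)\<close> embeds the representations by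
  \<open>u\<^sup>2 + D v\<^sup>2\<close> into those by \<open>u\<^sup>2 + E v\<^sup>2\<close>.
\<close>

lemma card_representations:
  fixes D :: int and n :: nat
  assumes D: "D > 0" and n: "n > 0"
  defines "A \<equiv> {(u, v). u\<^sup>2 + D * v\<^sup>2 = int n}"
  shows "finite A \<and> card A \<le> 18 * (divisor_count n)\<^sup>2"
proof -
  define E s where "E = squarefree_part D" and "s = square_part D"
  have DEs: "D = E * s\<^sup>2" using squarefree_decompose[of D] by (simp add: E_def s_def)
  have E: "squarefree E" by (simp add: E_def)
  have s: "s \<noteq> 0" using D by (simp add: s_def)
  have "E > 0" using D s by (simp add: DEs zero_less_mult_iff)
  let ?B = "{(u, v). u\<^sup>2 + E * v\<^sup>2 = int n}"
  let ?f = "\<lambda>(u, v). (u, s * v)"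
  have B: "finite ?B \<and> card ?B \<le> divisor_count n * (divisor_count n * 18)"
    by (rule card_representations_squarefree[OF E \<open>E > 0\<close> n])
  have inj: "inj_on ?f A" using s by (auto simp: inj_on_def)
  have sub: "?f ` A \<subseteq> ?B" by (auto simp: A_def DEs power_mult_distrib mult.assoc)
  show ?thesis
    using inj_on_finite[OF inj sub] card_inj_on_le[OF inj sub] B by (simp add: power2_eq_square)
qed

section \<open>Distances between points of a circle\<close>

lemma inner_real2: "(x::real^2) \<bullet> y = x$1 * y$1 + x$2 * y$2"
  by (simp add: inner_vec_def sum_2)

lemma dist_real2_sq: "(dist (x::real^2) y)\<^sup>2 = (x$1 - y$1)\<^sup>2 + (x$2 - y$2)\<^sup>2"
  by (simp add: dist_norm power2_norm_eq_inner inner_real2 power2_eq_square[of "_ $ _ - _"])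

text \<open>
  By Heron's formula the bracket is \<open>16\<close> times the squared area of the triangle \<open>PQX\<close>, so this is
  the classical \<open>4 r \<cdot> area = a b d\<close>, squared. It serves as an inscribed angle theorem: it says that
  \<open>(a\<^sup>2 + b\<^sup>2 - d\<^sup>2)\<^sup>2 / (a b)\<^sup>2 = 4 - d\<^sup>2 / r\<^sup>2\<close>, independently of \<open>X\<close>. In terms of the inner
  products of \<open>P, Q, X\<close> taken from the centre it is the vanishing of the Gram determinant of three
  vectors in the plane.
\<close>

lemma circumradius_identity:
  fixes P Q X c :: "real^2"
  assumes "P \<in> sphere c r" "Q \<in> sphere c r" "X \<in> sphere c r"
  defines "a \<equiv> dist P X" and "b \<equiv> dist Q X" and "d \<equiv> dist P Q"
  shows "r\<^sup>2 * (4 * a\<^sup>2 * b\<^sup>2 - (a\<^sup>2 + b\<^sup>2 - d\<^sup>2)\<^sup>2) = a\<^sup>2 * b\<^sup>2 * d\<^sup>2"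
proof -
  define p q x where "p = P - c" and "q = Q - c" and "x = X - c"
  define \<rho> \<alpha> \<beta> \<gamma> where "\<rho> = r\<^sup>2" and "\<alpha> = p \<bullet> x" and "\<beta> = q \<bullet> x" and "\<gamma> = p \<bullet> q"
  have np: "p \<bullet> p = \<rho>" and nq: "q \<bullet> q = \<rho>" and nx: "x \<bullet> x = \<rho>"
    using assms(1-3) by (auto simp: p_def q_def x_def \<rho>_def dist_norm norm_minus_commute simp flip: power2_norm_eq_inner)
  have a: "a\<^sup>2 = 2 * (\<rho> - \<alpha>)"
  proof -
    have "a\<^sup>2 = (p - x) \<bullet> (p - x)" by (simp add: a_def p_def x_def dist_norm power2_norm_eq_inner)
    then show ?thesis by (simp add: inner_diff np nx \<alpha>_def inner_commute)
  qed
  have b: "b\<^sup>2 = 2 * (\<rho> - \<beta>)"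
  proof -
    have "b\<^sup>2 = (q - x) \<bullet> (q - x)" by (simp add: b_def q_def x_def dist_norm power2_norm_eq_inner)
    then show ?thesis by (simp add: inner_diff nq nx \<beta>_def inner_commute)
  qed
  have d: "d\<^sup>2 = 2 * (\<rho> - \<gamma>)"
  proof -
    have "d\<^sup>2 = (p - q) \<bullet> (p - q)" by (simp add: d_def p_def q_def dist_norm power2_norm_eq_inner)
    then show ?thesis by (simp add: inner_diff np nq \<gamma>_def inner_commute)
  qed
  have "(p \<bullet> p) * (q \<bullet> q) * (x \<bullet> x) + 2 * \<alpha> * \<beta> * \<gamma>
     - (p \<bullet> p) * \<beta>\<^sup>2 - (q \<bullet> q) * \<alpha>\<^sup>2 - (x \<bullet> x) * \<gamma>\<^sup>2 = 0"
    unfolding \<alpha>_def \<beta>_def \<gamma>_def inner_real2 by algebra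
  then have gram: "\<rho> * \<rho> * \<rho> + 2 * \<alpha> * \<beta> * \<gamma> - \<rho> * \<beta>\<^sup>2 - \<rho> * \<alpha>\<^sup>2 - \<rho> * \<gamma>\<^sup>2 = 0"
    by (simp only: np nq nx)
  show ?thesis unfolding a b d \<rho>_def[symmetric] using gram by algebra
qed

text \<open>
  The two points are mirror images in the line \<open>PQ\<close>: the distances determine the inner product of
  \<open>Q - P\<close> and \<open>X - P\<close> and the square of their cross product \<open>cr X\<close>, so only the sign of \<open>cr X\<close>
  is free.
\<close>

lemma card_points_with_given_distances:
  fixes P Q :: "real^2"
  assumes "P \<noteq> Q"
  shows "finite {X. dist P X = a \<and> dist Q X = b} \<and> card {X. dist P X = a \<and> dist Q X = b} \<le> 2"
proof -
  let ?A = "{X. dist P X = a \<and> dist Q X = b}"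
  define w where "w = Q - P"
  define cr where "cr = (\<lambda>X::real^2. w$1 * (X$2 - P$2) - w$2 * (X$1 - P$1))"
  have w0: "(w$1)\<^sup>2 + (w$2)\<^sup>2 \<noteq> 0"
    using assms by (auto simp: w_def sum_power2_eq_zero_iff vec_eq_iff forall_2)
  have inj: "inj_on (\<lambda>X. cr X \<ge> 0) ?A"
  proof (rule inj_onI)
    fix X Y assume X: "X \<in> ?A" and Y: "Y \<in> ?A" and eq: "(cr X \<ge> 0) = (cr Y \<ge> 0)"
    have "(dist P X)\<^sup>2 = (dist P Y)\<^sup>2" "(dist Q X)\<^sup>2 = (dist Q Y)\<^sup>2" using X Y by auto
    then have 1: "(X$1 - P$1)\<^sup>2 + (X$2 - P$2)\<^sup>2 = (Y$1 - P$1)\<^sup>2 + (Y$2 - P$2)\<^sup>2"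
      and 2: "(X$1 - Q$1)\<^sup>2 + (X$2 - Q$2)\<^sup>2 = (Y$1 - Q$1)\<^sup>2 + (Y$2 - Q$2)\<^sup>2"
      by (simp_all add: dist_real2_sq power2_commute)
    have dot: "w$1 * (X$1 - P$1) + w$2 * (X$2 - P$2) = w$1 * (Y$1 - P$1) + w$2 * (Y$2 - P$2)"
      using 1 2 by (simp add: w_def power2_eq_square algebra_simps)
    have "(cr X)\<^sup>2 = (cr Y)\<^sup>2" using 1 dot unfolding cr_def by algebra
    then have cr: "cr X = cr Y" using eq by (auto simp: power2_eq_iff)
    have "((w$1)\<^sup>2 + (w$2)\<^sup>2) * (X$1 - Y$1) = 0" "((w$1)\<^sup>2 + (w$2)\<^sup>2) * (X$2 - Y$2) = 0"
      using cr dot unfolding cr_def by algebra+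
    then show "X = Y" using w0 unfolding mult_eq_0_iff vec_eq_iff forall_2 by linarith
  qed
  have "finite ?A" by (rule inj_on_finite[OF inj, of UNIV]) auto
  moreover have "card ?A \<le> card (UNIV :: bool set)" by (rule card_inj_on_le[OF inj]) auto
  ultimately show ?thesis by simp
qed

text \<open>
  Every \<open>X\<close> other than \<open>P, Q\<close> comes from a representation \<open>(u, v)\<close> of \<open>n\<close>, a sign \<open>\<sigma>\<close> and one of at
  most two points with the resulting distances, which gives \<open>18 \<tau>(n)\<^sup>2 * 2 * 2\<close> points; the
  points \<open>P, Q\<close> themselves are paid for by \<open>2 \<tau>(n)\<^sup>2\<close>.
\<close>

lemma card_integer_distance_set_on_circle:
  fixes T :: "(real^2) set"
  assumes T: "integer_distance_set T" "T \<subseteq> sphere c r"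
    and r: "r > 0"
    and pts: "P \<in> T" "Q \<in> T" "Z \<in> T" "P \<noteq> Q" "P \<noteq> Z" "Q \<noteq> Z"
    and n: "real n = 4 * (dist P Z * dist Q Z * dist P Q)\<^sup>2"
  shows "finite T \<and> card T \<le> 74 * (divisor_count n)\<^sup>2"
proof -
  have dist_int: "\<exists>k::int. dist X Y = real_of_int k" if "X \<in> T" "Y \<in> T" for X Y
    using T(1) that unfolding integer_distance_set_def by (auto elim!: Ints_cases)
  obtain a0 b0 d :: int where
    a0: "dist P Z = real_of_int a0" and b0: "dist Q Z = real_of_int b0" and d: "dist P Q = real_of_int d"
    using dist_int pts by metis
  have pos: "a0 > 0" "b0 > 0" "d > 0"
    using pts a0 b0 d zero_less_dist_iff[of P Z] zero_less_dist_iff[of Q Z] zero_less_dist_iff[of P Q] by auto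
  define f e D where "f = a0 * b0" and "e = a0\<^sup>2 + b0\<^sup>2 - d\<^sup>2" and "D = 4 * f\<^sup>2 - e\<^sup>2"
  have f: "f > 0" using pos by (simp add: f_def)
  have circ: "r\<^sup>2 * real_of_int (4 * a\<^sup>2 * b\<^sup>2 - (a\<^sup>2 + b\<^sup>2 - d\<^sup>2)\<^sup>2) = real_of_int (a\<^sup>2 * b\<^sup>2 * d\<^sup>2)"
    if "X \<in> T" "dist P X = real_of_int a" "dist Q X = real_of_int b" for X a b
  proof -
    have "r\<^sup>2 * (4 * (dist P X)\<^sup>2 * (dist Q X)\<^sup>2 - ((dist P X)\<^sup>2 + (dist Q X)\<^sup>2 - (dist P Q)\<^sup>2)\<^sup>2)
        = (dist P X)\<^sup>2 * (dist Q X)\<^sup>2 * (dist P Q)\<^sup>2"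
      using T(2) pts that(1) by (intro circumradius_identity) blast+
    then show ?thesis by (simp only: that(2,3) d of_int_mult of_int_diff of_int_add of_int_power of_int_numeral)
  qed
  have circ0: "r\<^sup>2 * real_of_int D = real_of_int (f\<^sup>2 * d\<^sup>2)"
    using circ[OF pts(3) a0 b0] by (simp add: D_def f_def e_def power_mult_distrib mult.assoc)
  have D0: "D > 0"
  proof -
    have "r\<^sup>2 * real_of_int D > 0" using f pos unfolding circ0 by simp
    then show ?thesis using r by (simp add: zero_less_mult_iff)
  qed
  have n_int: "int n = 4 * f\<^sup>2 * d\<^sup>2"
  proof -
    have "real_of_int (int n) = real_of_int (4 * f\<^sup>2 * d\<^sup>2)"
      using n by (simp add: a0 b0 d f_def power_mult_distrib)
    then show ?thesis by (simp only: of_int_eq_iff)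
  qed
  have n0: "n > 0" using n_int f pos by (metis mult_pos_pos of_nat_0_less_iff zero_less_numeral zero_less_power)
  define A where "A = {(u, v). u\<^sup>2 + D * v\<^sup>2 = int n}"
  have A: "finite A" "card A \<le> 18 * (divisor_count n)\<^sup>2"
    using card_representations[OF D0 n0] by (auto simp: A_def)
  \<comment> \<open>\<open>F\<close> inverts \<open>u = 2 f a - \<sigma> e b\<close>, \<open>v = b\<close>.\<close>
  define F where "F = (\<lambda>((u, v), \<sigma>::int). {X. dist P X = real_of_int ((u + \<sigma> * e * v) div (2 * f)) \<and> dist Q X = real_of_int v})"
  have cover: "T - {P, Q} \<subseteq> (\<Union>z\<in>A \<times> {-1, 1}. F z)"
  proof
    fix X assume X: "X \<in> T - {P, Q}"
    obtain a b :: int where a: "dist P X = real_of_int a" and b: "dist Q X = real_of_int b"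
      using dist_int pts X by (metis DiffD1)
    define g where "g = a\<^sup>2 + b\<^sup>2 - d\<^sup>2"
    have "r\<^sup>2 * real_of_int (4 * a\<^sup>2 * b\<^sup>2 - g\<^sup>2) = real_of_int (a\<^sup>2 * b\<^sup>2 * d\<^sup>2)"
      using circ[OF _ a b] X by (simp add: g_def)
    then have "r\<^sup>2 * real_of_int ((e * (a * b))\<^sup>2) = r\<^sup>2 * real_of_int ((f * g)\<^sup>2)"
      using circ0 unfolding D_def of_int_mult of_int_diff of_int_power of_int_numeral by algebra
    then have "(e * (a * b))\<^sup>2 = (f * g)\<^sup>2" using r by (simp only: mult_cancel_left of_int_eq_iff) simp
    then have "f * g = 1 * (e * (a * b)) \<or> f * g = -1 * (e * (a * b))"
      by (auto simp: power2_eq_iff)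
    then obtain \<sigma> where \<sigma>: "\<sigma> \<in> {-1, 1}" and fg: "f * g = \<sigma> * (e * (a * b))"
      by blast
    have \<sigma>2: "\<sigma>\<^sup>2 = 1" using \<sigma> by auto
    let ?u = "2 * f * a - \<sigma> * e * b"
    have "?u\<^sup>2 + D * b\<^sup>2 = 4 * f\<^sup>2 * d\<^sup>2"
      using fg \<sigma>2 unfolding D_def g_def by algebra
    then have "((?u, b), \<sigma>) \<in> A \<times> {-1, 1}" using \<sigma> by (simp add: A_def n_int)
    moreover have "X \<in> F ((?u, b), \<sigma>)" using f a b by (simp add: F_def)
    ultimately show "X \<in> (\<Union>z\<in>A \<times> {-1, 1}. F z)" by blast
  qed
  have fibre: "finite (F z) \<and> card (F z) \<le> 2" for z
    unfolding F_def using card_points_with_given_distances[OF pts(4)] by (auto split: prod.split)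
  have "finite (T - {P, Q}) \<and> card (T - {P, Q}) \<le> card (A \<times> {-1, 1::int}) * 2"
    by (rule card_le_by_cover[OF _ cover fibre]) (use A in auto)
  then have *: "finite (T - {P, Q})" "card (T - {P, Q}) \<le> 72 * (divisor_count n)\<^sup>2"
    using A by (auto simp: card_cartesian_product)
  have "divisor_count n > 0" using n0 by (auto simp: divisor_count_def card_gt_0_iff)
  then have "2 \<le> 2 * (divisor_count n)\<^sup>2" by simp
  moreover have "card T \<le> card (T - {P, Q}) + 2"
    using pts *(1) card_Diff_subset[of "{P,Q}" T] by simp
  ultimately show ?thesis using * by auto
qed

section \<open>The bound for the points in a square\<close>

lemma dist_centered_square:
  assumes "x \<in> centered_square N" "y \<in> centered_square N"
  shows "dist x y \<le> 4 * N"
proof -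
  have l1: "dist x y \<le> \<bar>(x - y)$1\<bar> + \<bar>(x - y)$2\<bar>"
    using norm_le_l1_cart[of "x - y"] by (simp add: dist_norm sum_2)
  have comp: "\<bar>(x - y)$i\<bar> \<le> 2 * N" for i
  proof -
    have "x$i \<in> {-N..N}" "y$i \<in> {-N..N}" using assms by (auto simp: centered_square_def)
    then show ?thesis by auto
  qed
  show ?thesis using l1 comp[of 1] comp[of 2] by linarith
qed

lemma finite_card_le_2_or_three_points:
  obtains "finite T" "card T \<le> 2"
  | P Q Z where "P \<in> T" "Q \<in> T" "Z \<in> T" "P \<noteq> Q" "P \<noteq> Z" "Q \<noteq> Z"
proof (cases "finite T \<and> card T \<le> 2")
  case False
  then obtain B where B: "B \<subseteq> T" "card B = 3"
    using infinite_arbitrarily_large[of T 3] obtain_subset_with_card_n[of 3 T] by force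
  from B(2) obtain P Q Z where "B = {P, Q, Z}" "P \<noteq> Q" "P \<noteq> Z" "Q \<noteq> Z"
    by (auto simp: card_3_iff)
  with B(1) that(2) show ?thesis by auto
qed (use that in auto)

theorem proposition1p6:
  "\<exists>A B N\<^sub>0 :: real. A > 0 \<and> B > 0 \<and> N\<^sub>0 > 0 \<and>
     (\<forall>N \<ge> N\<^sub>0. \<forall>C S :: (real ^ 2) set.
        circle C \<longrightarrow> integer_distance_set S \<longrightarrow> S \<subseteq> C \<longrightarrow>
          finite (S \<inter> centered_square N) \<and>
          real (card (S \<inter> centered_square N)) \<le> A * N powr (B / ln (ln N)))"
proof -
  have "eventually (\<lambda>N::real. ln (ln N) > 0) at_top" by real_asymp
  \<comment> \<open>The distances are at most \<open>4 N\<close>, so \<open>n \<le> 4 * (4 N) ^ 6 = 16384 * N ^ 6\<close>, which is at most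
    \<open>N ^ 7\<close> as soon as \<open>N \<ge> 16384\<close>.\<close>
  then have "eventually (\<lambda>N::real. N \<ge> 16384 \<and> ln (ln N) > 0 \<and> (\<forall>n>0. real n \<le> N ^ 7 \<longrightarrow>
     real (divisor_count n) \<le> N powr (15 / ln (ln N)))) at_top"
    by (intro eventually_conj eventually_ge_at_top eventually_divisor_count_bound)
  then obtain N0 :: real where N0: "\<And>N. N \<ge> N0 \<Longrightarrow> N \<ge> 16384 \<and> ln (ln N) > 0 \<and> (\<forall>n>0. real n \<le> N ^ 7 \<longrightarrow>
     real (divisor_count n) \<le> N powr (15 / ln (ln N)))"
    by (auto simp: eventually_at_top_linorder)
  have main: "finite (S \<inter> centered_square N) \<and>
      real (card (S \<inter> centered_square N)) \<le> 74 * N powr (30 / ln (ln N))"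
    if N: "N \<ge> N0" and C: "circle C" and S: "integer_distance_set S" "S \<subseteq> C" for N C S
  proof -
    define T where "T = S \<inter> centered_square N"
    have big: "N \<ge> 16384" and lnln: "ln (ln N) > 0" using N0[OF N] by auto
    obtain c r where r: "r > 0" "C = sphere c r" using C by (auto simp: circle_def)
    have T: "integer_distance_set T" "T \<subseteq> sphere c r"
      using S r by (auto simp: T_def integer_distance_set_def)
    consider "finite T" "card T \<le> 2"
      | P Q Z where "P \<in> T" "Q \<in> T" "Z \<in> T" "P \<noteq> Q" "P \<noteq> Z" "Q \<noteq> Z"
      by (rule finite_card_le_2_or_three_points)
    then have "finite T \<and> real (card T) \<le> 74 * N powr (30 / ln (ln N))"
    proof cases
      case 1
      have "N powr (30 / ln (ln N)) \<ge> 1" using big lnln by (intro ge_one_powr_ge_zero) auto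
      then show ?thesis using 1 by linarith
    next
      case (2 P Q Z)
      let ?p = "dist P Z * dist Q Z * dist P Q"
      have "?p \<in> \<int>" using T(1) 2 by (auto simp: integer_distance_set_def)
      then obtain k where k: "?p = real_of_int k" by (auto elim: Ints_cases)
      define n where "n = nat (4 * k\<^sup>2)"
      have n: "real n = 4 * ?p\<^sup>2" by (simp add: n_def k)
      have "?p > 0" using 2(4-6) by (intro mult_pos_pos) auto
      then have "real n > 0" unfolding n by (intro mult_pos_pos zero_less_power) auto
      then have n0: "n > 0" by simp
      have dle: "dist X Y \<le> 4 * N" if "X \<in> T" "Y \<in> T" for X Y
        using dist_centered_square that by (auto simp: T_def)
      have "?p \<le> (4 * N) * (4 * N) * (4 * N)"
        using 2 dle big by (intro mult_mono) auto
      then have "?p\<^sup>2 \<le> ((4 * N) * (4 * N) * (4 * N))\<^sup>2" by (intro power_mono) auto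
      then have "real n \<le> 16384 * N ^ 6" unfolding n by (simp add: eval_nat_numeral algebra_simps)
      also have "\<dots> \<le> N * N ^ 6" using big by (intro mult_right_mono) auto
      also have "\<dots> = N ^ 7" by (simp add: eval_nat_numeral)
      finally have dc: "real (divisor_count n) \<le> N powr (15 / ln (ln N))" using N0[OF N] n0 by blast
      have fin: "finite T" "card T \<le> 74 * (divisor_count n)\<^sup>2"
        using card_integer_distance_set_on_circle[OF T r(1) 2 n] by auto
      have "real (card T) \<le> 74 * (real (divisor_count n))\<^sup>2"
        using fin(2) by (metis of_nat_le_iff of_nat_mult of_nat_numeral of_nat_power)
      also have "\<dots> \<le> 74 * (N powr (15 / ln (ln N)))\<^sup>2"
        using dc by (intro mult_left_mono power_mono) auto
      also have "(N powr (15 / ln (ln N)))\<^sup>2 = N powr (30 / ln (ln N))"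
        by (simp add: power2_eq_square powr_add[symmetric])
      finally show ?thesis using fin(1) by blast
    qed
    then show ?thesis by (simp add: T_def)
  qed
  have "(74::real) > 0" "(30::real) > 0" "max N0 1 > 0" by auto
  then show ?thesis using main by (metis max.bounded_iff)
qed

end
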